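(* Let $A$ be a $\mathbb{C}[\partial]$-module with three $\mathbb{C}$-bilinear maps $\prec_\lambda,\succ_\lambda,\vee_\lambda:A\otimes A\to A[\lambda]$ and two commuting $\mathbb{C}$-linear maps $\alpha,\beta:A\to A$ that are multiplicative with respect to $\succ_\lambda,\prec_\lambda$ and $\vee_\lambda$. Define $p*_\lambda q=p\prec_\lambda q+p\succ_\lambda q+p\vee_\lambda q$ for all $p,q\in A$. Then $(A,\prec_\lambda,\succ_\lambda,\vee_\lambda,\alpha,\beta)$ is a BiHom-NS-conformal algebra if and only if $(A,*_\lambda,\alpha,\beta)$ is a BiHom-associative conformal algebra and $(A,\alpha,\beta)$, with left action $p_\lambda m=p\succ_\lambda m$ and right action $m_\lambda p=m\prec_\lambda p$, is a conformal $(A,*_\lambda,\alpha,\beta)$-bimodule.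
   Context: All vector spaces, linear maps and tensor products are over $\mathbb{C}$; $\lambda,\mu$ are formal variables. For a $\mathbb{C}[\partial]$-module $V$ put $V[\lambda]=\mathbb{C}[\lambda]\otimes V$. A $\mathbb{C}$-bilinear map $U\otimes V\to W[\lambda]$, $u\otimes v\mapsto u\circ_\lambda v$, is conformal sesquilinear if $(\partial u)\circ_\lambda v=-\lambda(u\circ_\lambda v)$ and $u\circ_\lambda(\partial v)=(\partial+\lambda)(u\circ_\lambda v)$. Linear maps and products are extended coefficientwise to polynomials in $\lambda,\mu$; e.g. if $u\circ_\lambda v=\sum_i\lambda^i a_i$ then $(u\circ_\lambda v)\circ_{\lambda+\mu}w=\sum_i\lambda^i(a_i\circ_{\lambda+\mu}w)$. A map $\alpha$ is multiplicative for $\circ_\lambda$ if $\alpha(p\circ_\lambda q)=\alpha(p)\circ_\lambda\alpha(q)$. A BiHom-associative conformal algebra $(A,\cdot_\lambda,\alpha,\beta)$, with product written $p_\lambda q$, is a $\mathbb{C}[\partial]$-module $A$ with a conformal sesquilinear map $A\otimes A\to A[\lambda]$, $p\otimes q\mapsto p_\lambda q$, and commuting $\mathbb{C}$-linear maps $\alpha,\beta:A\to A$ commuting with $\partial$ and multiplicative, such that $\alpha(p)_\lambda(q_\mu r)=(p_\lambda q)_{\lambda+\mu}\beta(r)$. A BiHom-NS-conformal algebra $(A,\prec_\lambda,\succ_\lambda,\vee_\lambda,\alpha,\beta)$ is a $\mathbb{C}[\partial]$-module $A$ with conformal sesquilinear maps $\prec_\lambda,\succ_\lambda,\vee_\lambda:A\otimes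 A\to A[\lambda]$ and commuting $\mathbb{C}$-linear maps $\alpha,\beta:A\to A$ commuting with $\partial$ and multiplicative for all three products, such that, with $p*_\lambda q=p\prec_\lambda q+p\succ_\lambda q+p\vee_\lambda q$, for all $p,q,r\in A$: $(p\prec_\lambda q)\prec_{\lambda+\mu}\beta(r)=\alpha(p)\prec_\lambda(q*_\mu r)$; $(p\succ_\lambda q)\prec_{\lambda+\mu}\beta(r)=\alpha(p)\succ_\lambda(q\prec_\mu r)$; $(p*_\lambda q)\succ_{\lambda+\mu}\beta(r)=\alpha(p)\succ_\lambda(q\succ_\mu r)$; $(p\vee_\lambda q)\prec_{\lambda+\mu}\beta(r)+(p*_\lambda q)\vee_{\lambda+\mu}\beta(r)=\alpha(p)\succ_\lambda(q\vee_\mu r)+\alpha(p)\vee_\lambda(q*_\mu r)$. A conformal bimodule over a BiHom-associative conformal algebra $(A,\cdot_\lambda,\alpha_A,\beta_A)$ is a $\mathbb{C}[\partial]$-module $M$ with commuting $\mathbb{C}$-linear maps $\alpha_M,\beta_M:M\to M$ commuting with $\partial$ and conformal sesquilinear maps $A\otimes M\to M[\lambda]$, $p\otimes m\mapsto p_\lambda m$, and $M\otimes A\to M[\lambda]$, $m\otimes p\mapsto m_\lambda p$, such that $\alpha_M(p_\lambda m)=\alpha_A(p)_\lambda\alpha_M(m)$, $\alpha_M(m_\lambda p)=\alpha_M(m)_\lambda\alpha_A(p)$, the same for $\beta$, and $(p_\lambda q)_{\lambda+\mu}\beta_M(m)=\alpha_A(p)_\lambda(q_\mu m)$, $(m_\lambda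 p)_{\lambda+\mu}\beta_A(q)=\alpha_M(m)_\lambda(p_\mu q)$, $(p_\lambda m)_{\lambda+\mu}\beta_A(q)=\alpha_A(p)_\lambda(m_\mu q)$ for all $p,q\in A$, $m\in M$. *)

theory Defs
  imports Complex_Main "HOL-Computational_Algebra.Polynomial"
begin

text \<open>
  A \<open>\<complex>[\<partial>]\<close>-module is a \<open>module\<close> over the ring \<open>complex poly\<close>; the polynomial variable acts as
  \<open>\<partial>\<close> and the constant polynomials give the underlying complex vector space.
\<close>

type_synonym 'a cpoly_action = "complex poly \<Rightarrow> 'a \<Rightarrow> 'a"

definition del :: "'a cpoly_action \<Rightarrow> 'a \<Rightarrow> 'a" where
  "del s = s [:0, 1:]"

definition cscale :: "'a cpoly_action \<Rightarrow> complex \<Rightarrow> 'a \<Rightarrow> 'a" where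
  "cscale s c = s [:c:]"

text \<open>
  \<open>V[\<lambda>]\<close> is \<open>'v poly\<close>: an element is determined by its finitely many nonzero coefficients in \<open>V\<close>,
  and multiplication by \<open>\<lambda>\<close> is \<open>pCons 0\<close>. A linear map is extended coefficientwise by \<open>map_poly\<close>.
\<close>

definition cscale_poly :: "'v::ab_group_add cpoly_action \<Rightarrow> complex \<Rightarrow> 'v poly \<Rightarrow> 'v poly" where
  "cscale_poly s c = map_poly (cscale s c)"

definition cbilinear ::
  "'u::ab_group_add cpoly_action \<Rightarrow> 'v::ab_group_add cpoly_action \<Rightarrow> 'w::ab_group_add cpoly_action \<Rightarrow>
    ('u \<Rightarrow> 'v \<Rightarrow> 'w poly) \<Rightarrow> bool" where
  "cbilinear sU sV sW prd \<longleftrightarrow>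
    (\<forall>v. Vector_Spaces.linear (cscale sU) (cscale_poly sW) (\<lambda>u. prd u v)) \<and>
    (\<forall>u. Vector_Spaces.linear (cscale sV) (cscale_poly sW) (\<lambda>v. prd u v))"

definition conformal_sesquilinear ::
  "'u::ab_group_add cpoly_action \<Rightarrow> 'v::ab_group_add cpoly_action \<Rightarrow> 'w::ab_group_add cpoly_action \<Rightarrow>
    ('u \<Rightarrow> 'v \<Rightarrow> 'w poly) \<Rightarrow> bool" where
  "conformal_sesquilinear sU sV sW prd \<longleftrightarrow>
    cbilinear sU sV sW prd \<and>
    (\<forall>u v. prd (del sU u) v = - pCons 0 (prd u v)) \<and>
    (\<forall>u v. prd u (del sV v) = map_poly (del sW) (prd u v) + pCons 0 (prd u v))"

definition multiplicative :: "('a::zero \<Rightarrow> 'a) \<Rightarrow> ('a \<Rightarrow> 'a \<Rightarrow> 'a poly) \<Rightarrow> bool" where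
  "multiplicative f prd \<longleftrightarrow> (\<forall>p q. map_poly f (prd p q) = prd (f p) (f q))"

text \<open>
  \<open>V[\<lambda>,\<mu>]\<close> is \<open>'v poly poly\<close>, with \<open>\<mu>\<close> the outer and \<open>\<lambda>\<close> the inner variable.
\<close>

definition mult_lambda :: "'v::ab_group_add poly poly \<Rightarrow> 'v poly poly" where
  "mult_lambda = map_poly (pCons 0)"

definition mult_mu :: "'v::ab_group_add poly poly \<Rightarrow> 'v poly poly" where
  "mult_mu = pCons 0"

text \<open>Substitution of \<open>\<lambda> + \<mu>\<close> for the variable: \<open>\<Sum>\<^sub>k \<nu>\<^sup>k c\<^sub>k\<close> becomes \<open>\<Sum>\<^sub>k (\<lambda> + \<mu>)\<^sup>k c\<^sub>k\<close>.\<close>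

definition subst_lambda_plus_mu :: "'v::ab_group_add poly \<Rightarrow> 'v poly poly" where
  "subst_lambda_plus_mu P =
    (\<Sum>k\<le>degree P. ((\<lambda>Q. mult_lambda Q + mult_mu Q) ^^ k) [:[:coeff P k:]:])"

text \<open>For \<open>P\<close> in \<open>V[\<mu>]\<close>, \<open>prod_lambda prd u P\<close> is \<open>u \<circ>\<^sub>\<lambda> P\<close>.\<close>

definition prod_lambda ::
  "('u \<Rightarrow> 'v::ab_group_add \<Rightarrow> 'w::ab_group_add poly) \<Rightarrow> 'u \<Rightarrow> 'v poly \<Rightarrow> 'w poly poly" where
  "prod_lambda prd u P = map_poly (prd u) P"

text \<open>For \<open>P = \<Sum>\<^sub>i \<lambda>\<^sup>i a\<^sub>i\<close>, \<open>prod_lambda_mu prd P v\<close> is \<open>P \<circ>\<^bsub>\<lambda>+\<mu>\<^esub> v = \<Sum>\<^sub>i \<lambda>\<^sup>i (a\<^sub>i \<circ>\<^bsub>\<lambda>+\<mu>\<^esub> v)\<close>.\<close>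

definition prod_lambda_mu ::
  "('u::ab_group_add \<Rightarrow> 'v \<Rightarrow> 'w::ab_group_add poly) \<Rightarrow> 'u poly \<Rightarrow> 'v \<Rightarrow> 'w poly poly" where
  "prod_lambda_mu prd P v =
    (\<Sum>i\<le>degree P. (mult_lambda ^^ i) (subst_lambda_plus_mu (prd (coeff P i) v)))"

locale bihom_module = module s
  for s :: "complex poly \<Rightarrow> 'a::ab_group_add \<Rightarrow> 'a" +
  fixes \<alpha> \<beta> :: "'a \<Rightarrow> 'a"
  assumes linear_alpha: "Vector_Spaces.linear (cscale s) (cscale s) \<alpha>"
    and linear_beta: "Vector_Spaces.linear (cscale s) (cscale s) \<beta>"
    and alpha_beta_commute: "\<alpha> (\<beta> x) = \<beta> (\<alpha> x)"
    and alpha_del: "\<alpha> (del s x) = del s (\<alpha> x)"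
    and beta_del: "\<beta> (del s x) = del s (\<beta> x)"

locale bihom_assoc_conformal_algebra = bihom_module s \<alpha> \<beta>
  for s :: "complex poly \<Rightarrow> 'a::ab_group_add \<Rightarrow> 'a"
    and prd :: "'a \<Rightarrow> 'a \<Rightarrow> 'a poly"
    and \<alpha> \<beta> :: "'a \<Rightarrow> 'a" +
  assumes sesquilinear: "conformal_sesquilinear s s s prd"
    and multiplicative_alpha: "multiplicative \<alpha> prd"
    and multiplicative_beta: "multiplicative \<beta> prd"
    and assoc: "prod_lambda prd (\<alpha> p) (prd q r) = prod_lambda_mu prd (prd p q) (\<beta> r)"

text \<open>\<open>lt\<close>, \<open>gt\<close>, \<open>vee\<close> are the products \<open>\<prec>\<^sub>\<lambda>\<close>, \<open>\<succ>\<^sub>\<lambda>\<close>, \<open>\<or>\<^sub>\<lambda>\<close>.\<close>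

definition ns_star ::
  "('a \<Rightarrow> 'a \<Rightarrow> 'a::ab_group_add poly) \<Rightarrow> ('a \<Rightarrow> 'a \<Rightarrow> 'a poly) \<Rightarrow> ('a \<Rightarrow> 'a \<Rightarrow> 'a poly) \<Rightarrow>
    'a \<Rightarrow> 'a \<Rightarrow> 'a poly" where
  "ns_star lt gt vee p q = lt p q + gt p q + vee p q"

locale bihom_ns_conformal_algebra = bihom_module s \<alpha> \<beta>
  for s :: "complex poly \<Rightarrow> 'a::ab_group_add \<Rightarrow> 'a"
    and lt gt vee :: "'a \<Rightarrow> 'a \<Rightarrow> 'a poly"
    and \<alpha> \<beta> :: "'a \<Rightarrow> 'a" +
  assumes sesquilinear_lt: "conformal_sesquilinear s s s lt"
    and sesquilinear_gt: "conformal_sesquilinear s s s gt"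
    and sesquilinear_vee: "conformal_sesquilinear s s s vee"
    and multiplicative_alpha: "multiplicative \<alpha> lt" "multiplicative \<alpha> gt" "multiplicative \<alpha> vee"
    and multiplicative_beta: "multiplicative \<beta> lt" "multiplicative \<beta> gt" "multiplicative \<beta> vee"
    and lt_lt:
      "prod_lambda_mu lt (lt p q) (\<beta> r) = prod_lambda lt (\<alpha> p) (ns_star lt gt vee q r)"
    and gt_lt:
      "prod_lambda_mu lt (gt p q) (\<beta> r) = prod_lambda gt (\<alpha> p) (lt q r)"
    and star_gt:
      "prod_lambda_mu gt (ns_star lt gt vee p q) (\<beta> r) = prod_lambda gt (\<alpha> p) (gt q r)"
    and vee_lt_star_vee:
      "prod_lambda_mu lt (vee p q) (\<beta> r) + prod_lambda_mu vee (ns_star lt gt vee p q) (\<beta> r) =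
       prod_lambda gt (\<alpha> p) (vee q r) + prod_lambda vee (\<alpha> p) (ns_star lt gt vee q r)"

locale conformal_bimodule =
  A: bihom_assoc_conformal_algebra sA prd \<alpha>A \<beta>A + M: bihom_module sM \<alpha>M \<beta>M
  for sA :: "complex poly \<Rightarrow> 'a::ab_group_add \<Rightarrow> 'a"
    and prd :: "'a \<Rightarrow> 'a \<Rightarrow> 'a poly"
    and \<alpha>A \<beta>A :: "'a \<Rightarrow> 'a"
    and sM :: "complex poly \<Rightarrow> 'm::ab_group_add \<Rightarrow> 'm"
    and \<alpha>M \<beta>M :: "'m \<Rightarrow> 'm" +
  fixes lact :: "'a \<Rightarrow> 'm \<Rightarrow> 'm poly"
    and ract :: "'m \<Rightarrow> 'a \<Rightarrow> 'm poly"
  assumes sesquilinear_lact: "conformal_sesquilinear sA sM sM lact"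
    and sesquilinear_ract: "conformal_sesquilinear sM sA sM ract"
    and alpha_lact: "map_poly \<alpha>M (lact p m) = lact (\<alpha>A p) (\<alpha>M m)"
    and alpha_ract: "map_poly \<alpha>M (ract m p) = ract (\<alpha>M m) (\<alpha>A p)"
    and beta_lact: "map_poly \<beta>M (lact p m) = lact (\<beta>A p) (\<beta>M m)"
    and beta_ract: "map_poly \<beta>M (ract m p) = ract (\<beta>M m) (\<beta>A p)"
    and left_module:
      "prod_lambda_mu lact (prd p q) (\<beta>M m) = prod_lambda lact (\<alpha>A p) (lact q m)"
    and right_module:
      "prod_lambda_mu ract (ract m p) (\<beta>A q) = prod_lambda ract (\<alpha>M m) (prd p q)"
    and middle:
      "prod_lambda_mu ract (lact p m) (\<beta>A q) = prod_lambda lact (\<alpha>A p) (ract m q)"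

end

theory Submission
  imports Defs
begin

text \<open>
  The three bimodule axioms of \<open>(A, \<alpha>, \<beta>)\<close> over \<open>(A, *\<^sub>\<lambda>)\<close>, with \<open>\<succ>\<^sub>\<lambda>\<close> acting on the left and \<open>\<prec>\<^sub>\<lambda>\<close>
  on the right, are literally the first three axioms of a BiHom-NS-conformal algebra. What remains is
  to compare associativity of \<open>*\<^sub>\<lambda>\<close> with the fourth axiom. Both sides of the associativity identity
  are additive in the inner and in the outer product, so that expanding \<open>*\<^sub>\<lambda>\<close> into its three summands turns
  the identity into the sum of the four NS axioms. Given the first three axioms, associativity is
  therefore equivalent to the fourth (lemma \<open>ns_star_assoc_iff\<close>).

  The same cancellation handles sesquilinearity: the \<open>\<partial>\<close>-conditions are additive in the product, and
  hence, once they hold for \<open>\<prec>\<^sub>\<lambda>\<close> and \<open>\<succ>\<^sub>\<lambda>\<close>, they hold for \<open>*\<^sub>\<lambda>\<close> if and only if they hold for \<open>\<or>\<^sub>\<lambda>\<close>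
  (lemma \<open>ns_star_sesquilinear_iff\<close>). Compatibility of \<open>\<alpha>\<close> and \<open>\<beta>\<close> with \<open>\<partial>\<close> is not among the
  hypotheses, but it is part of the structure on both sides of the equivalence.
\<close>

lemma map_poly_add:
  assumes "additive f"
  shows "map_poly f (P + Q) = map_poly f P + map_poly f Q"
  using assms by (intro poly_eqI) (simp add: coeff_map_poly additive.add additive.zero)

lemma additive_funpow:
  fixes f :: "'a::ab_group_add \<Rightarrow> 'a"
  assumes "additive f"
  shows "additive (f ^^ k)"
  using assms by (induction k) (auto simp: additive_def)

text \<open>
  Both \<open>subst_lambda_plus_mu\<close> and \<open>prod_lambda_mu\<close> sum over the coefficients of a polynomial up to
  its degree. The degree is not additive, but additive summands vanish at zero coefficients, so
  that the range of summation can be enlarged to a common bound.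
\<close>

lemma sum_over_coeffs_add:
  fixes F :: "nat \<Rightarrow> 'a::ab_group_add \<Rightarrow> 'b::ab_group_add"
  assumes F: "\<And>i. additive (F i)"
  shows "(\<Sum>i\<le>degree (P + Q). F i (coeff (P + Q) i)) =
    (\<Sum>i\<le>degree P. F i (coeff P i)) + (\<Sum>i\<le>degree Q. F i (coeff Q i))"
proof -
  define n where "n = max (degree P) (degree Q)"
  have extend: "(\<Sum>i\<le>degree R. F i (coeff R i)) = (\<Sum>i\<le>n. F i (coeff R i))" if "degree R \<le> n" for R
    using that by (intro sum.mono_neutral_left) (auto simp: coeff_eq_0 additive.zero[OF F])
  have "degree (P + Q) \<le> n" "degree P \<le> n" "degree Q \<le> n"
    by (auto simp: n_def degree_add_le_max)
  then show ?thesis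
    by (simp only: extend) (simp add: additive.add[OF F] sum.distrib)
qed

lemma additive_mult_lambda: "additive mult_lambda"
  unfolding mult_lambda_def by (intro additive.intro map_poly_add) simp

lemma additive_mult_mu: "additive mult_mu"
  by (simp add: additive_def mult_mu_def)

lemma additive_subst_lambda_plus_mu:
  "additive (subst_lambda_plus_mu :: 'a::ab_group_add poly \<Rightarrow> 'a poly poly)"
proof -
  have "additive (\<lambda>Q :: 'a poly poly. mult_lambda Q + mult_mu Q)"
    by (intro additive.intro)
      (simp add: additive.add[OF additive_mult_lambda] additive.add[OF additive_mult_mu] ac_simps)
  then have "additive (\<lambda>c :: 'a. ((\<lambda>Q. mult_lambda Q + mult_mu Q) ^^ k) [:[:c:]:])" for k
    by (intro additive.intro) (simp flip: additive.add[OF additive_funpow])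
  from sum_over_coeffs_add[OF this] show ?thesis
    unfolding subst_lambda_plus_mu_def by (rule additive.intro)
qed

lemma prod_lambda_add_right:
  assumes "additive (prd u)"
  shows "prod_lambda prd u (P + Q) = prod_lambda prd u P + prod_lambda prd u Q"
  unfolding prod_lambda_def by (rule map_poly_add[OF assms])

lemma prod_lambda_mu_add_left:
  assumes "additive (\<lambda>u. prd u v)"
  shows "prod_lambda_mu prd (P + Q) v = prod_lambda_mu prd P v + prod_lambda_mu prd Q v"
  unfolding prod_lambda_mu_def
  by (intro sum_over_coeffs_add)
    (simp add: additive_def additive.add[OF assms] additive.add[OF additive_subst_lambda_plus_mu]
      additive.add[OF additive_funpow[OF additive_mult_lambda]])

lemma prod_lambda_ns_star:
  assumes "additive (lt u)" and "additive (gt u)" and "additive (vee u)"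
  shows "prod_lambda (ns_star lt gt vee) u P =
    prod_lambda lt u P + prod_lambda gt u P + prod_lambda vee u P"
  using assms[THEN additive.zero]
  by (intro poly_eqI) (simp add: prod_lambda_def coeff_map_poly ns_star_def)

lemma prod_lambda_mu_ns_star:
  "prod_lambda_mu (ns_star lt gt vee) P v =
    prod_lambda_mu lt P v + prod_lambda_mu gt P v + prod_lambda_mu vee P v"
  by (simp add: prod_lambda_mu_def ns_star_def sum.distrib
      additive.add[OF additive_subst_lambda_plus_mu]
      additive.add[OF additive_funpow[OF additive_mult_lambda]])

lemma linear_imp_additive:
  assumes "Vector_Spaces.linear sU sV f"
  shows "additive f"
proof -
  interpret Vector_Spaces.linear sU sV f by fact
  show ?thesis by (rule additive.intro) (rule add)
qed

lemma cbilinear_additive: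
  assumes "cbilinear sU sV sW prd"
  shows "additive (prd u)" and "additive (\<lambda>u. prd u v)"
  using assms by (auto simp: cbilinear_def intro: linear_imp_additive)

lemma linear_add:
  assumes f: "Vector_Spaces.linear sU sV f" and g: "Vector_Spaces.linear sU sV g"
  shows "Vector_Spaces.linear sU sV (\<lambda>x. f x + g x)"
proof -
  interpret f: Vector_Spaces.linear sU sV f by fact
  interpret vector_space_pair sU sV ..
  show ?thesis by (rule linear_compose_add[OF f g])
qed

lemma cbilinear_ns_star:
  assumes "cbilinear sU sU sU lt" and "cbilinear sU sU sU gt" and "cbilinear sU sU sU vee"
  shows "cbilinear sU sU sU (ns_star lt gt vee)"
  unfolding cbilinear_def ns_star_def
  by (intro conjI allI linear_add) (use assms in \<open>simp_all add: cbilinear_def\<close>)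

lemma multiplicative_ns_star:
  assumes "additive f" and "multiplicative f lt" and "multiplicative f gt" and "multiplicative f vee"
  shows "multiplicative f (ns_star lt gt vee)"
  using assms by (simp add: multiplicative_def ns_star_def map_poly_add)

lemma ns_star_sesquilinear_iff:
  assumes "module s" and "cbilinear s s s vee"
    and lt: "conformal_sesquilinear s s s lt" and gt: "conformal_sesquilinear s s s gt"
  shows "conformal_sesquilinear s s s (ns_star lt gt vee) \<longleftrightarrow> conformal_sesquilinear s s s vee"
proof -
  interpret module s by fact
  have "additive (del s)"
    by (simp add: additive_def del_def scale_right_distrib)
  note del_add = map_poly_add[OF this]
  have pCons_add: "pCons 0 (P + Q) = pCons 0 P + pCons 0 Q" for P Q :: "'a poly"
    by simp
  have "cbilinear s s s (ns_star lt gt vee)"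
    using assms by (intro cbilinear_ns_star) (auto simp: conformal_sesquilinear_def)
  moreover have "ns_star lt gt vee (del s u) v = - pCons 0 (ns_star lt gt vee u v) \<longleftrightarrow>
      vee (del s u) v = - pCons 0 (vee u v)" for u v
  proof -
    have "- pCons 0 (ns_star lt gt vee u v) =
        - pCons 0 (lt u v) + - pCons 0 (gt u v) + - pCons 0 (vee u v)"
      by (simp add: ns_star_def)
    moreover have "ns_star lt gt vee (del s u) v =
        - pCons 0 (lt u v) + - pCons 0 (gt u v) + vee (del s u) v"
      using lt gt by (simp add: conformal_sesquilinear_def ns_star_def)
    ultimately show ?thesis
      by (simp only: add_left_cancel)
  qed
  moreover have "ns_star lt gt vee u (del s v) =
        map_poly (del s) (ns_star lt gt vee u v) + pCons 0 (ns_star lt gt vee u v) \<longleftrightarrow>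
      vee u (del s v) = map_poly (del s) (vee u v) + pCons 0 (vee u v)" for u v
  proof -
    have "map_poly (del s) (ns_star lt gt vee u v) + pCons 0 (ns_star lt gt vee u v) =
        (map_poly (del s) (lt u v) + pCons 0 (lt u v)) +
        (map_poly (del s) (gt u v) + pCons 0 (gt u v)) +
        (map_poly (del s) (vee u v) + pCons 0 (vee u v))"
      unfolding ns_star_def del_add pCons_add by (simp only: ac_simps)
    moreover have "ns_star lt gt vee u (del s v) =
        (map_poly (del s) (lt u v) + pCons 0 (lt u v)) +
        (map_poly (del s) (gt u v) + pCons 0 (gt u v)) + vee u (del s v)"
      using lt gt by (simp add: conformal_sesquilinear_def ns_star_def)
    ultimately show ?thesis
      by (simp only: add_left_cancel)
  qed
  ultimately show ?thesis
    using assms(2) by (simp add: conformal_sesquilinear_def)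
qed

text \<open>
  Writing \<open>x\<close> for \<open>\<alpha> p\<close> and \<open>y\<close> for \<open>\<beta> r\<close>, the left side \<open>x *\<^sub>\<lambda> (q *\<^sub>\<mu> r)\<close> splits into
  \<open>x \<prec>\<^sub>\<lambda> (q *\<^sub>\<mu> r)\<close>, \<open>x \<succ>\<^sub>\<lambda> (q \<prec>\<^sub>\<mu> r)\<close>, \<open>x \<succ>\<^sub>\<lambda> (q \<succ>\<^sub>\<mu> r)\<close> and the right side of the fourth axiom; the right
  side \<open>(p *\<^sub>\<lambda> q) *\<^bsub>\<lambda>+\<mu>\<^esub> y\<close> splits into \<open>(p \<prec>\<^sub>\<lambda> q) \<prec>\<^bsub>\<lambda>+\<mu>\<^esub> y\<close>, \<open>(p \<succ>\<^sub>\<lambda> q) \<prec>\<^bsub>\<lambda>+\<mu>\<^esub> y\<close>, \<open>(p *\<^sub>\<lambda> q) \<succ>\<^bsub>\<lambda>+\<mu>\<^esub> y\<close> and the left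
  side of the fourth axiom. The first three axioms match the first three terms.
\<close>

lemma ns_star_assoc_iff:
  assumes lt: "cbilinear s s s lt" and gt: "cbilinear s s s gt" and vee: "cbilinear s s s vee"
    and lt_lt: "prod_lambda_mu lt (lt p q) y = prod_lambda lt x (ns_star lt gt vee q r)"
    and gt_lt: "prod_lambda_mu lt (gt p q) y = prod_lambda gt x (lt q r)"
    and star_gt: "prod_lambda_mu gt (ns_star lt gt vee p q) y = prod_lambda gt x (gt q r)"
  shows "prod_lambda (ns_star lt gt vee) x (ns_star lt gt vee q r) =
      prod_lambda_mu (ns_star lt gt vee) (ns_star lt gt vee p q) y \<longleftrightarrow>
    prod_lambda_mu lt (vee p q) y + prod_lambda_mu vee (ns_star lt gt vee p q) y =
      prod_lambda gt x (vee q r) + prod_lambda vee x (ns_star lt gt vee q r)"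
    (is "?L = ?R \<longleftrightarrow> ?l = ?r")
proof -
  let ?c = "prod_lambda lt x (ns_star lt gt vee q r) + prod_lambda gt x (lt q r) +
    prod_lambda gt x (gt q r)"
  have "prod_lambda gt x (ns_star lt gt vee q r) =
      prod_lambda gt x (lt q r) + prod_lambda gt x (gt q r) + prod_lambda gt x (vee q r)"
    by (simp add: ns_star_def prod_lambda_add_right cbilinear_additive[OF gt])
  then have left: "?L = ?c + ?r"
    by (simp add: prod_lambda_ns_star cbilinear_additive[OF lt] cbilinear_additive[OF gt]
        cbilinear_additive[OF vee] add.assoc)
  have "prod_lambda_mu lt (ns_star lt gt vee p q) y =
      prod_lambda_mu lt (lt p q) y + prod_lambda_mu lt (gt p q) y + prod_lambda_mu lt (vee p q) y"
    by (simp add: ns_star_def prod_lambda_mu_add_left cbilinear_additive[OF lt])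
  then have right: "?R = ?c + ?l"
    unfolding prod_lambda_mu_ns_star lt_lt gt_lt star_gt by (simp only: ac_simps)
  show ?thesis
    unfolding left right by auto
qed

theorem proposition2p13:
  fixes s :: "complex poly \<Rightarrow> 'a::ab_group_add \<Rightarrow> 'a"
    and lt gt vee :: "'a \<Rightarrow> 'a \<Rightarrow> 'a poly"
    and \<alpha> \<beta> :: "'a \<Rightarrow> 'a"
  assumes "module s"
    and "cbilinear s s s lt" and "cbilinear s s s gt" and "cbilinear s s s vee"
    and "Vector_Spaces.linear (cscale s) (cscale s) \<alpha>"
    and "Vector_Spaces.linear (cscale s) (cscale s) \<beta>"
    and "\<And>x. \<alpha> (\<beta> x) = \<beta> (\<alpha> x)"
    and "multiplicative \<alpha> gt" and "multiplicative \<alpha> lt" and "multiplicative \<alpha> vee"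
    and "multiplicative \<beta> gt" and "multiplicative \<beta> lt" and "multiplicative \<beta> vee"
  shows "bihom_ns_conformal_algebra s lt gt vee \<alpha> \<beta> \<longleftrightarrow>
    bihom_assoc_conformal_algebra s (ns_star lt gt vee) \<alpha> \<beta> \<and>
    conformal_bimodule s (ns_star lt gt vee) \<alpha> \<beta> s \<alpha> \<beta> gt lt"
proof
  assume "bihom_ns_conformal_algebra s lt gt vee \<alpha> \<beta>"
  then interpret N: bihom_ns_conformal_algebra s lt gt vee \<alpha> \<beta> .
  have star: "bihom_assoc_conformal_algebra s (ns_star lt gt vee) \<alpha> \<beta>"
  proof
    show "conformal_sesquilinear s s s (ns_star lt gt vee)"
      using ns_star_sesquilinear_iff[OF assms(1,4) N.sesquilinear_lt N.sesquilinear_gt]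
        N.sesquilinear_vee by blast
    show "multiplicative \<alpha> (ns_star lt gt vee)" "multiplicative \<beta> (ns_star lt gt vee)"
      using assms by (auto intro: multiplicative_ns_star linear_imp_additive)
    show "prod_lambda (ns_star lt gt vee) (\<alpha> p) (ns_star lt gt vee q r) =
        prod_lambda_mu (ns_star lt gt vee) (ns_star lt gt vee p q) (\<beta> r)" for p q r
      using ns_star_assoc_iff[OF assms(2-4) N.lt_lt N.gt_lt N.star_gt] N.vee_lt_star_vee by blast
  qed
  moreover have "conformal_bimodule s (ns_star lt gt vee) \<alpha> \<beta> s \<alpha> \<beta> gt lt"
  proof (intro conformal_bimodule.intro conformal_bimodule_axioms.intro)
    show "bihom_assoc_conformal_algebra s (ns_star lt gt vee) \<alpha> \<beta>" by (rule star)
    show "bihom_module s \<alpha> \<beta>" by (rule N.bihom_module_axioms)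
  qed (use N.sesquilinear_gt N.sesquilinear_lt N.multiplicative_alpha N.multiplicative_beta
      N.star_gt N.lt_lt N.gt_lt in \<open>simp_all add: multiplicative_def\<close>)
  ultimately show "bihom_assoc_conformal_algebra s (ns_star lt gt vee) \<alpha> \<beta> \<and>
    conformal_bimodule s (ns_star lt gt vee) \<alpha> \<beta> s \<alpha> \<beta> gt lt" ..
next
  assume "bihom_assoc_conformal_algebra s (ns_star lt gt vee) \<alpha> \<beta> \<and>
    conformal_bimodule s (ns_star lt gt vee) \<alpha> \<beta> s \<alpha> \<beta> gt lt"
  then interpret B: conformal_bimodule s "ns_star lt gt vee" \<alpha> \<beta> s \<alpha> \<beta> gt lt
    by blast
  show "bihom_ns_conformal_algebra s lt gt vee \<alpha> \<beta>"
  proof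
    show "conformal_sesquilinear s s s vee"
      using ns_star_sesquilinear_iff[OF assms(1,4) B.sesquilinear_ract B.sesquilinear_lact]
        B.A.sesquilinear by blast
    show "prod_lambda_mu lt (vee p q) (\<beta> r) + prod_lambda_mu vee (ns_star lt gt vee p q) (\<beta> r) =
        prod_lambda gt (\<alpha> p) (vee q r) + prod_lambda vee (\<alpha> p) (ns_star lt gt vee q r)" for p q r
      using ns_star_assoc_iff[OF assms(2-4) B.right_module B.middle B.left_module] B.A.assoc by blast
  qed (fact assms B.sesquilinear_ract B.sesquilinear_lact B.right_module B.middle B.left_module)+
qed

end
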